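(* Let $K$ be a field of characteristic $\neq 2$, $n\ge1$, and let $\mathcal C$ be an EACP over $K$ with natural basis $\{h_1,\dots,h_n,r\}$ and structural constants $a_{ij},b_i$, and suppose $\det(a_{ij})_{i,j=1}^n\neq0$. For $a\in\mathcal C$ let $L_a:\mathcal C\to\mathcal C$, $L_a(x)=ax$, and write $L_i=L_{h_i}$. Then the set of all left multiplication operators $\{L_a: a\in\mathcal C\}$ equals the linear span of $\{L_1,\dots,L_n,L_r\}$, the map $a\mapsto L_a$ is injective, and this span has the same dimension $n+1$ as $\mathcal C$ (so $\{L_1,\dots,L_n,L_r\}$ is a basis of it).
   Context: An EACP over a field $K$ (characteristic $\neq 2$) is a $K$-algebra $\mathcal C$ with a basis $\{h_1,\dots,h_n,r\}$ (called a natural basis) whose multiplication is determined by bilinearity from $$h_ir=rh_i=\tfrac12\Big(\sum_{j=1}^n a_{ij}h_j+b_ir\Big),\qquad h_ih_j=0\ (i,j=1,\dots,n),\qquad rr=0,$$ for some constants $a_{ij},b_i\in K$. *)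

theory Defs
  imports "HOL-Analysis.Analysis" "HOL-Library.Function_Algebras"
begin

text \<open>An EACP with natural basis h_1..h_n, r is modelled on coordinate vectors
  'k^('n option): index Some i is the coordinate of h_i, index None that of r.
  Structural constants: A i j = a_ij, b i = b_i.\<close>

definition eacp_basis :: "'n option \<Rightarrow> 'k::field^('n::finite option)" where
  "eacp_basis p = axis p 1"

text \<open>Multiplication table on the natural basis.\<close>
definition eacp_table :: "('n::finite \<Rightarrow> 'n \<Rightarrow> 'k::field) \<Rightarrow> ('n \<Rightarrow> 'k)
    \<Rightarrow> 'n option \<Rightarrow> 'n option \<Rightarrow> 'k^('n option)" where
  "eacp_table A b p q =
     (case (p, q) of
        (Some i, None) \<Rightarrow> (1/2) *s ((\<Sum>j\<in>UNIV. A i j *s eacp_basis (Some j)) + b i *s eacp_basis None)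
      | (None, Some i) \<Rightarrow> (1/2) *s ((\<Sum>j\<in>UNIV. A i j *s eacp_basis (Some j)) + b i *s eacp_basis None)
      | _ \<Rightarrow> 0)"

text \<open>Multiplication, determined by bilinearity from the table.\<close>
definition eacp_mult :: "('n::finite \<Rightarrow> 'n \<Rightarrow> 'k::field) \<Rightarrow> ('n \<Rightarrow> 'k)
    \<Rightarrow> 'k^('n option) \<Rightarrow> 'k^('n option) \<Rightarrow> 'k^('n option)" where
  "eacp_mult A b x y = (\<Sum>p\<in>UNIV. \<Sum>q\<in>UNIV. (x $ p * y $ q) *s eacp_table A b p q)"

text \<open>Left multiplication operator L_a.\<close>
definition eacp_L :: "('n::finite \<Rightarrow> 'n \<Rightarrow> 'k::field) \<Rightarrow> ('n \<Rightarrow> 'k)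
    \<Rightarrow> 'k^('n option) \<Rightarrow> ('k^('n option) \<Rightarrow> 'k^('n option))" where
  "eacp_L A b a = (\<lambda>x. eacp_mult A b a x)"

text \<open>Pointwise scalar multiplication on operators C \<rightarrow> C (K-vector space structure).\<close>
definition op_scale :: "'k::field \<Rightarrow> ('v \<Rightarrow> 'k^'m) \<Rightarrow> ('v \<Rightarrow> 'k^'m)" where
  "op_scale c f = (\<lambda>x. c *s f x)"

end

theory Submission
  imports Defs
begin

text \<open>Write \<open>a = \<Sum>i. \<alpha>\<^sub>i h\<^sub>i + \<beta> r\<close> and \<open>\<rho>\<^sub>i = \<Sum>j. a\<^sub>i\<^sub>j h\<^sub>j + b\<^sub>i r\<close>. Then
  \<open>L\<^sub>a r = 1/2 \<Sum>i. \<alpha>\<^sub>i \<rho>\<^sub>i\<close> and \<open>L\<^sub>a h\<^sub>k = 1/2 \<beta> \<rho>\<^sub>k\<close>. If \<open>L\<^sub>a = 0\<close>, the first identity says that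
  \<open>\<alpha>\<close> lies in the left kernel of the invertible matrix \<open>(a\<^sub>i\<^sub>j)\<close>, so \<open>\<alpha> = 0\<close>; the second forces
  \<open>\<beta> = 0\<close>, since no row of an invertible matrix vanishes. Thus \<open>a \<mapsto> L\<^sub>a\<close> is an injective
  linear map sending the natural basis to \<open>L\<^sub>1, \<dots>, L\<^sub>n, L\<^sub>r\<close>, and its range is their span,
  of dimension \<open>n + 1\<close>.\<close>

definition eacp_row :: "('n::finite \<Rightarrow> 'n \<Rightarrow> 'k::field) \<Rightarrow> ('n \<Rightarrow> 'k) \<Rightarrow> 'n \<Rightarrow> 'k^('n option)" where
  "eacp_row A b i = (\<Sum>j\<in>UNIV. A i j *s eacp_basis (Some j)) + b i *s eacp_basis None"

lemma sum_UNIV_option: "sum f (UNIV :: 'n::finite option set) = f None + (\<Sum>i\<in>UNIV. f (Some i))"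
  by (simp add: UNIV_option_conv sum.reindex)

lemma eacp_basis_nth: "eacp_basis p $ q = (if q = p then 1 else 0)"
  by (simp add: eacp_basis_def axis_def)

lemma eacp_row_nth_Some [simp]: "eacp_row A b i $ Some j = A i j"
  by (simp add: eacp_row_def eacp_basis_nth sum_component if_distrib cong: if_cong)

lemma eacp_row_nth_None [simp]: "eacp_row A b i $ None = b i"
  by (simp add: eacp_row_def eacp_basis_nth sum_component)

lemma eacp_mult_eq:
  "eacp_mult A b x y =
     (\<Sum>i\<in>UNIV. ((x $ Some i * y $ None + x $ None * y $ Some i) / 2) *s eacp_row A b i)"
  unfolding eacp_mult_def eacp_table_def eacp_row_def[symmetric]
  by (simp add: sum_UNIV_option sum.distrib algebra_simps vector_smult_assoc
      add_divide_distrib vector_sadd_rdistrib)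

lemma eacp_mult_basis_None:
  "eacp_mult A b x (eacp_basis None) = (\<Sum>i\<in>UNIV. (x $ Some i / 2) *s eacp_row A b i)"
  by (simp add: eacp_mult_eq eacp_basis_nth)

lemma eacp_mult_basis_Some:
  "eacp_mult A b x (eacp_basis (Some k)) = (x $ None / 2) *s eacp_row A b k"
proof -
  have "eacp_mult A b x (eacp_basis (Some k))
      = (\<Sum>i\<in>UNIV. if i = k then (x $ None / 2) *s eacp_row A b k else 0)"
    unfolding eacp_mult_eq by (rule sum.cong) (auto simp: eacp_basis_nth)
  then show ?thesis by simp
qed

lemma vector_space_op_scale: "vector_space (op_scale :: 'k::field \<Rightarrow> ('v \<Rightarrow> 'k^'m) \<Rightarrow> _)"
  by unfold_locales (auto simp: op_scale_def fun_eq_iff vec.scale_right_distrib vec.scale_left_distrib)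

lemma linear_eacp_L: "Vector_Spaces.linear (*s) op_scale (eacp_L A b)"
proof (rule linear_module_homI)
  show "module_hom (*s) op_scale (eacp_L A b)"
    unfolding module_hom_def module_hom_axioms_def module_iff_vector_space
    using vec.vector_space_axioms vector_space_op_scale
    by (auto simp: eacp_L_def op_scale_def eacp_mult_eq fun_eq_iff algebra_simps
        add_divide_distrib sum.distrib vec.scale_sum_right vector_sadd_rdistrib vector_smult_assoc)
qed

lemma vector_matrix_mult_eq_0_imp:
  fixes M :: "'k::field^'n^'n"
  assumes "det M \<noteq> 0" and "x v* M = 0"
  shows "x = 0"
proof -
  have "invertible (transpose M)"
    using assms(1) by (simp add: invertible_det_nz det_transpose)
  then show ?thesis
    using assms(2) inj_matrix_vector_mult by (metis injD matrix_vector_mult_0_right transpose_matrix_vector)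
qed

lemma eacp_L_eq_0_imp:
  fixes A :: "'n::finite \<Rightarrow> 'n \<Rightarrow> 'k::field"
  assumes char: "(2::'k) \<noteq> 0"
    and det: "det (\<chi> i j. A i j) \<noteq> 0"
    and L0: "eacp_L A b a = 0"
  shows "a = 0"
proof -
  let ?M = "(\<chi> i j. A i j) :: 'k^'n^'n"
  have mult0: "eacp_mult A b a y = 0" for y
    using L0 by (simp add: eacp_L_def fun_eq_iff)
  have "(\<Sum>i\<in>UNIV. a $ Some i / 2 * A i j) = 0" for j
    using arg_cong[where f = "\<lambda>v. v $ Some j", OF mult0[of "eacp_basis None"]]
    by (simp add: eacp_mult_basis_None sum_component)
  then have "(\<chi> i. a $ Some i / 2) v* ?M = 0"
    by (simp add: vec_eq_iff vector_matrix_mult_def mult.commute)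
  then have "(\<chi> i. a $ Some i / 2) = 0"
    using det by (rule vector_matrix_mult_eq_0_imp[rotated])
  then have aSome: "a $ Some i = 0" for i
    using char by (simp add: vec_eq_iff)
  have aNone: "a $ None = 0"
  proof (rule ccontr)
    assume "a $ None \<noteq> 0"
    then have "eacp_row A b k = 0" for k
      using mult0[of "eacp_basis (Some k)"] char by (simp add: eacp_mult_basis_Some)
    then have "row k ?M = 0" for k
      by (simp add: row_def vec_eq_iff) (metis eacp_row_nth_Some zero_index)
    then show False
      using det det_zero_row(2) by blast
  qed
  show ?thesis
    using aSome aNone by (simp add: vec_eq_iff) (metis not_None_eq)
qed

lemma vector_space_pair_cart_op_scale:
  "finite_dimensional_vector_space_pair_1 (*s) (cart_basis :: ('k::field^'m) set)
     (op_scale :: 'k \<Rightarrow> ('v \<Rightarrow> 'k^'l) \<Rightarrow> _)"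
  unfolding finite_dimensional_vector_space_pair_1_def
  using vec.finite_dimensional_vector_space_axioms vector_space_op_scale by blast

lemma inj_eacp_L:
  fixes A :: "'n::finite \<Rightarrow> 'n \<Rightarrow> 'k::field"
  assumes "(2::'k) \<noteq> 0" and "det (\<chi> i j. A i j) \<noteq> 0"
  shows "inj (eacp_L A b)"
proof -
  interpret finite_dimensional_vector_space_pair_1 "(*s)" cart_basis
    "op_scale :: 'k \<Rightarrow> ('k^'n option \<Rightarrow> 'k^'n option) \<Rightarrow> _"
    by (rule vector_space_pair_cart_op_scale)
  show ?thesis
    using linear_inj_iff_eq_0[OF linear_eacp_L] eacp_L_eq_0_imp[OF assms] by blast
qed

lemma range_eq_span_image_cart_basis:
  fixes f :: "'k::field^'m \<Rightarrow> ('v \<Rightarrow> 'k^'l)"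
  assumes "Vector_Spaces.linear (*s) op_scale f"
  shows "range f = module.span op_scale (f ` cart_basis)"
proof -
  interpret finite_dimensional_vector_space_pair_1 "(*s)" cart_basis op_scale
    by (rule vector_space_pair_cart_op_scale)
  show ?thesis
    using linear_span_image[OF assms, of cart_basis] by (simp add: vec.span_Basis)
qed

lemma dim_range_inj_linear:
  fixes f :: "'k::field^'m \<Rightarrow> ('v \<Rightarrow> 'k^'l)"
  assumes "Vector_Spaces.linear (*s) op_scale f" and "inj f"
  shows "vector_space.dim op_scale (range f) = CARD('m)"
proof -
  interpret finite_dimensional_vector_space_pair_1 "(*s)" cart_basis op_scale
    by (rule vector_space_pair_cart_op_scale)
  show ?thesis
    using dim_image_eq[OF assms(1), of UNIV] assms(2) by (simp add: inj_on_def inj_def card_cart_basis)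
qed

theorem mainTheorem10:
  fixes A :: "'n::finite \<Rightarrow> 'n \<Rightarrow> 'k::field" and b :: "'n \<Rightarrow> 'k"
  assumes char: "(2::'k) \<noteq> 0"
    and det: "det (\<chi> i j. A i j) \<noteq> 0"
  defines "Ls \<equiv> (\<lambda>i. eacp_L A b (eacp_basis (Some i))) ` UNIV \<union> {eacp_L A b (eacp_basis None)}"
  shows "range (eacp_L A b) = module.span op_scale Ls
     \<and> inj (eacp_L A b)
     \<and> vector_space.dim op_scale (module.span op_scale Ls) = CARD('n) + 1
     \<and> vector_space.dim op_scale (module.span op_scale Ls) = vec.dim (UNIV :: ('k^('n option)) set)"
proof -
  have "Ls = eacp_L A b ` cart_basis"
    unfolding Ls_def cart_basis_def eacp_basis_def by (auto simp: image_iff) (metis not_None_eq)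
  then have range: "range (eacp_L A b) = module.span op_scale Ls"
    using range_eq_span_image_cart_basis[OF linear_eacp_L] by simp
  have inj: "inj (eacp_L A b)"
    using inj_eacp_L[OF char det] .
  have "vector_space.dim op_scale (module.span op_scale Ls) = CARD('n option)"
    using dim_range_inj_linear[OF linear_eacp_L inj] range by simp
  then show ?thesis
    using range inj by (simp add: card_cart_basis)
qed

end
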